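(* Let $M$ be an object of an abelian category $\mathcal{A}$. (1) Assume that $\mathcal{A}$ is AB3*. Then the following are equivalent: (i) $M$ is strongly self-CS-Baer; (ii) $M$ is self-CS-Baer and weak duo; (iii) $M$ is self-CS-Baer and the ring $\mathrm{End}_{\mathcal{A}}(M)$ is abelian. (2) Assume that $\mathcal{A}$ is AB3. Then the following are equivalent: (i) $M$ is dual strongly self-CS-Baer; (ii) $M$ is dual self-CS-Baer and weak duo; (iii) $M$ is dual self-CS-Baer and the ring $\mathrm{End}_{\mathcal{A}}(M)$ is abelian.
   Context: An abelian category is AB3 (AB3* ) if it has arbitrary coproducts (products); it then has arbitrary sums (intersections) of families of subobjects. A subobject $i:K\to M$ is fully invariant if for every $h:M\to M$ one has $hi=i\alpha$ for some $\alpha:K\to K$. An object $M$ is weak duo if every direct summand of $M$ is fully invariant in $M$. A subobject $K\subseteq L$ is essential in $L$ if $K\cap X=0$ implies $X=0$ for every subobject $X$ of $L$; a subobject $K$ of $L$ is superfluous in $L$ if $K+X=L$ implies $X=L$ for every subobject $X$ of $L$. A subobject $L$ of $M$ lies above a direct summand $K$ of $M$ if $K\subseteq L$ and $L/K$ is superfluous in $M/K$. In an AB3* abelian category, $M$ is self-CS-Baer (strongly self-CS-Baer) if for every family $(f_i)_{i\in I}$ of morphisms $f_i:M\to M$, $\bigcap_{i\in I}\mathrm{Ker}(f_i)$ is essential in a direct summand (fully invariant direct summand) of $M$. In an AB3 abelian category, $M$ is dual self-CS-Baer (dual strongly self-CS-Baer) if for every family $(f_i)_{i\in I}$ of morphisms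 $f_i:M\to M$, $\sum_{i\in I}\mathrm{Im}(f_i)$ lies above a direct summand (fully invariant direct summand) of $M$. A ring is abelian if all its idempotents are central. *)

theory Defs
  imports "HOL-Algebra.Ring"
begin

section \<open>Abelian categories\<close>

record ('o, 'm) cat_data =
  Obj :: "'o set"
  Arr :: "'m set"
  Dom :: "'m \<Rightarrow> 'o"
  Cod :: "'m \<Rightarrow> 'o"
  Ident :: "'o \<Rightarrow> 'm"
  Comp :: "'m \<Rightarrow> 'm \<Rightarrow> 'm" (infixl "\<cdot>\<index>" 70)

record ('o, 'm) preadd_data = "('o, 'm) cat_data" +
  Add :: "'m \<Rightarrow> 'm \<Rightarrow> 'm" (infixl "\<boxplus>\<index>" 65)
  Zero :: "'o \<Rightarrow> 'o \<Rightarrow> 'm"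

definition Hom :: "('o, 'm, 'z) cat_data_scheme \<Rightarrow> 'o \<Rightarrow> 'o \<Rightarrow> 'm set" where
  "Hom C A B = {f \<in> Arr C. Dom C f = A \<and> Cod C f = B}"

locale category =
  fixes C :: "('o, 'm, 'z) cat_data_scheme" (structure)
  assumes Dom_in_Obj: "f \<in> Arr C \<Longrightarrow> Dom C f \<in> Obj C"
    and Cod_in_Obj: "f \<in> Arr C \<Longrightarrow> Cod C f \<in> Obj C"
    and Ident_in_Hom: "A \<in> Obj C \<Longrightarrow> Ident C A \<in> Hom C A A"
    and Comp_in_Hom: "\<lbrakk>f \<in> Hom C A B; g \<in> Hom C B D\<rbrakk> \<Longrightarrow> g \<cdot> f \<in> Hom C A D"
    and Comp_Ident: "f \<in> Hom C A B \<Longrightarrow> f \<cdot> Ident C A = f"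
    and Ident_Comp: "f \<in> Hom C A B \<Longrightarrow> Ident C B \<cdot> f = f"
    and Comp_assoc: "\<lbrakk>f \<in> Hom C A B; g \<in> Hom C B D; h \<in> Hom C D E\<rbrakk>
          \<Longrightarrow> (h \<cdot> g) \<cdot> f = h \<cdot> (g \<cdot> f)"

definition Hom_group :: "('o, 'm, 'z) preadd_data_scheme \<Rightarrow> 'o \<Rightarrow> 'o \<Rightarrow> 'm monoid" where
  "Hom_group C A B = \<lparr>carrier = Hom C A B, mult = Add C, one = Zero C A B\<rparr>"

locale preadditive_category = category C
  for C :: "('o, 'm, 'z) preadd_data_scheme" (structure) +
  assumes Hom_comm_group: "\<lbrakk>A \<in> Obj C; B \<in> Obj C\<rbrakk> \<Longrightarrow> comm_group (Hom_group C A B)"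
    and Comp_Add: "\<lbrakk>f \<in> Hom C A B; f' \<in> Hom C A B; g \<in> Hom C B D\<rbrakk>
          \<Longrightarrow> g \<cdot> (f \<boxplus> f') = (g \<cdot> f) \<boxplus> (g \<cdot> f')"
    and Add_Comp: "\<lbrakk>f \<in> Hom C A B; g \<in> Hom C B D; g' \<in> Hom C B D\<rbrakk>
          \<Longrightarrow> (g \<boxplus> g') \<cdot> f = (g \<cdot> f) \<boxplus> (g' \<cdot> f)"

definition is_mono :: "('o, 'm, 'z) cat_data_scheme \<Rightarrow> 'm \<Rightarrow> bool" where
  "is_mono C m \<longleftrightarrow> m \<in> Arr C \<and>
     (\<forall>X \<in> Obj C. \<forall>x \<in> Hom C X (Dom C m). \<forall>y \<in> Hom C X (Dom C m).
        m \<cdot>\<^bsub>C\<^esub> x = m \<cdot>\<^bsub>C\<^esub> y \<longrightarrow> x = y)"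

definition is_epi :: "('o, 'm, 'z) cat_data_scheme \<Rightarrow> 'm \<Rightarrow> bool" where
  "is_epi C e \<longleftrightarrow> e \<in> Arr C \<and>
     (\<forall>X \<in> Obj C. \<forall>x \<in> Hom C (Cod C e) X. \<forall>y \<in> Hom C (Cod C e) X.
        x \<cdot>\<^bsub>C\<^esub> e = y \<cdot>\<^bsub>C\<^esub> e \<longrightarrow> x = y)"

definition is_iso :: "('o, 'm, 'z) cat_data_scheme \<Rightarrow> 'm \<Rightarrow> bool" where
  "is_iso C f \<longleftrightarrow> f \<in> Arr C \<and>
     (\<exists>g \<in> Hom C (Cod C f) (Dom C f).
        g \<cdot>\<^bsub>C\<^esub> f = Ident C (Dom C f) \<and> f \<cdot>\<^bsub>C\<^esub> g = Ident C (Cod C f))"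

definition is_zero_object :: "('o, 'm, 'z) cat_data_scheme \<Rightarrow> 'o \<Rightarrow> bool" where
  "is_zero_object C Z \<longleftrightarrow> Z \<in> Obj C \<and>
     (\<forall>A \<in> Obj C. (\<exists>!f. f \<in> Hom C Z A) \<and> (\<exists>!f. f \<in> Hom C A Z))"

definition is_kernel :: "('o, 'm, 'z) preadd_data_scheme \<Rightarrow> 'm \<Rightarrow> 'm \<Rightarrow> bool" where
  "is_kernel C f k \<longleftrightarrow> f \<in> Arr C \<and> k \<in> Arr C \<and> Cod C k = Dom C f \<and>
     f \<cdot>\<^bsub>C\<^esub> k = Zero C (Dom C k) (Cod C f) \<and>
     (\<forall>X \<in> Obj C. \<forall>x \<in> Hom C X (Dom C f). f \<cdot>\<^bsub>C\<^esub> x = Zero C X (Cod C f) \<longrightarrow>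
        (\<exists>!y. y \<in> Hom C X (Dom C k) \<and> k \<cdot>\<^bsub>C\<^esub> y = x))"

definition is_cokernel :: "('o, 'm, 'z) preadd_data_scheme \<Rightarrow> 'm \<Rightarrow> 'm \<Rightarrow> bool" where
  "is_cokernel C f q \<longleftrightarrow> f \<in> Arr C \<and> q \<in> Arr C \<and> Dom C q = Cod C f \<and>
     q \<cdot>\<^bsub>C\<^esub> f = Zero C (Dom C f) (Cod C q) \<and>
     (\<forall>X \<in> Obj C. \<forall>x \<in> Hom C (Cod C f) X. x \<cdot>\<^bsub>C\<^esub> f = Zero C (Dom C f) X \<longrightarrow>
        (\<exists>!y. y \<in> Hom C (Cod C q) X \<and> y \<cdot>\<^bsub>C\<^esub> q = x))"

definition is_image :: "('o, 'm, 'z) preadd_data_scheme \<Rightarrow> 'm \<Rightarrow> 'm \<Rightarrow> bool" where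
  "is_image C f m \<longleftrightarrow> (\<exists>q. is_cokernel C f q \<and> is_kernel C q m)"

definition is_biproduct ::
    "('o, 'm, 'z) preadd_data_scheme \<Rightarrow> 'o \<Rightarrow> 'o \<Rightarrow> 'o \<Rightarrow> 'm \<Rightarrow> 'm \<Rightarrow> 'm \<Rightarrow> 'm \<Rightarrow> bool" where
  "is_biproduct C A B S i j p q \<longleftrightarrow>
     i \<in> Hom C A S \<and> j \<in> Hom C B S \<and> p \<in> Hom C S A \<and> q \<in> Hom C S B \<and>
     p \<cdot>\<^bsub>C\<^esub> i = Ident C A \<and> q \<cdot>\<^bsub>C\<^esub> j = Ident C B \<and>
     p \<cdot>\<^bsub>C\<^esub> j = Zero C B A \<and> q \<cdot>\<^bsub>C\<^esub> i = Zero C A B \<and>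
     (i \<cdot>\<^bsub>C\<^esub> p) \<boxplus>\<^bsub>C\<^esub> (j \<cdot>\<^bsub>C\<^esub> q) = Ident C S"

locale abelian_category = preadditive_category C
  for C :: "('o, 'm, 'z) preadd_data_scheme" (structure) +
  assumes zero_object: "\<exists>Z. is_zero_object C Z"
    and biproducts: "\<lbrakk>A \<in> Obj C; B \<in> Obj C\<rbrakk> \<Longrightarrow> \<exists>S i j p q. is_biproduct C A B S i j p q"
    and kernels: "f \<in> Arr C \<Longrightarrow> \<exists>k. is_kernel C f k"
    and cokernels: "f \<in> Arr C \<Longrightarrow> \<exists>q. is_cokernel C f q"
    and mono_normal: "is_mono C m \<Longrightarrow> \<exists>f. is_kernel C f m"
    and epi_normal: "is_epi C e \<Longrightarrow> \<exists>f. is_cokernel C f e"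


section \<open>Products and coproducts\<close>

definition is_product ::
    "('o, 'm, 'z) cat_data_scheme \<Rightarrow> 'i set \<Rightarrow> ('i \<Rightarrow> 'o) \<Rightarrow> 'o \<Rightarrow> ('i \<Rightarrow> 'm) \<Rightarrow> bool" where
  "is_product C I X P \<pi> \<longleftrightarrow> P \<in> Obj C \<and> (\<forall>i\<in>I. \<pi> i \<in> Hom C P (X i)) \<and>
     (\<forall>Y \<in> Obj C. \<forall>g. (\<forall>i\<in>I. g i \<in> Hom C Y (X i)) \<longrightarrow>
        (\<exists>!h. h \<in> Hom C Y P \<and> (\<forall>i\<in>I. \<pi> i \<cdot>\<^bsub>C\<^esub> h = g i)))"

definition is_coproduct ::
    "('o, 'm, 'z) cat_data_scheme \<Rightarrow> 'i set \<Rightarrow> ('i \<Rightarrow> 'o) \<Rightarrow> 'o \<Rightarrow> ('i \<Rightarrow> 'm) \<Rightarrow> bool" where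
  "is_coproduct C I X S \<iota> \<longleftrightarrow> S \<in> Obj C \<and> (\<forall>i\<in>I. \<iota> i \<in> Hom C (X i) S) \<and>
     (\<forall>Y \<in> Obj C. \<forall>g. (\<forall>i\<in>I. g i \<in> Hom C (X i) Y) \<longrightarrow>
        (\<exists>!h. h \<in> Hom C S Y \<and> (\<forall>i\<in>I. h \<cdot>\<^bsub>C\<^esub> \<iota> i = g i)))"

text \<open>
  The type \<open>'i\<close> supplies the small index sets: all families below, both in AB3* and AB3 and in the
  CS-Baer conditions, are indexed by arbitrary subsets of \<open>'i\<close>. It is independent of the types
  \<open>'o\<close> and \<open>'m\<close> of objects and morphisms, because products over all sets of morphisms would force
  the category to be degenerate (Freyd). The CS-Baer conditions depend only on the set of values of
  a family, so once \<open>'i\<close> has at least as many elements as \<open>End(M)\<close>, they cover all families.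
\<close>

definition AB3_star :: "('o, 'm, 'z) cat_data_scheme \<Rightarrow> 'i itself \<Rightarrow> bool" where
  "AB3_star C (_ :: 'i itself) \<longleftrightarrow>
     (\<forall>(I :: 'i set) X. (\<forall>i\<in>I. X i \<in> Obj C) \<longrightarrow> (\<exists>P \<pi>. is_product C I X P \<pi>))"

definition AB3 :: "('o, 'm, 'z) cat_data_scheme \<Rightarrow> 'i itself \<Rightarrow> bool" where
  "AB3 C (_ :: 'i itself) \<longleftrightarrow>
     (\<forall>(I :: 'i set) X. (\<forall>i\<in>I. X i \<in> Obj C) \<longrightarrow> (\<exists>S \<iota>. is_coproduct C I X S \<iota>))"


section \<open>Subobjects\<close>

text \<open>
  A subobject of \<open>M\<close> is represented by a monomorphism into \<open>M\<close>; two of them are the same subobject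
  iff each factors through the other. All notions below are invariant under this identification.
\<close>

definition subobject :: "('o, 'm, 'z) cat_data_scheme \<Rightarrow> 'o \<Rightarrow> 'm \<Rightarrow> bool" where
  "subobject C M k \<longleftrightarrow> is_mono C k \<and> Cod C k = M"

definition sub_le :: "('o, 'm, 'z) cat_data_scheme \<Rightarrow> 'm \<Rightarrow> 'm \<Rightarrow> bool" where
  "sub_le C k l \<longleftrightarrow> (\<exists>h \<in> Hom C (Dom C k) (Dom C l). k = l \<cdot>\<^bsub>C\<^esub> h)"

definition is_intersection ::
    "('o, 'm, 'z) cat_data_scheme \<Rightarrow> 'o \<Rightarrow> 'i set \<Rightarrow> ('i \<Rightarrow> 'm) \<Rightarrow> 'm \<Rightarrow> bool" where
  "is_intersection C M I \<kappa> k \<longleftrightarrow> (\<forall>i\<in>I. subobject C M (\<kappa> i)) \<and>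
     subobject C M k \<and> (\<forall>i\<in>I. sub_le C k (\<kappa> i)) \<and>
     (\<forall>x. subobject C M x \<and> (\<forall>i\<in>I. sub_le C x (\<kappa> i)) \<longrightarrow> sub_le C x k)"

definition is_sum ::
    "('o, 'm, 'z) cat_data_scheme \<Rightarrow> 'o \<Rightarrow> 'i set \<Rightarrow> ('i \<Rightarrow> 'm) \<Rightarrow> 'm \<Rightarrow> bool" where
  "is_sum C M I \<mu> s \<longleftrightarrow> (\<forall>i\<in>I. subobject C M (\<mu> i)) \<and>
     subobject C M s \<and> (\<forall>i\<in>I. sub_le C (\<mu> i) s) \<and>
     (\<forall>x. subobject C M x \<and> (\<forall>i\<in>I. sub_le C (\<mu> i) x) \<longrightarrow> sub_le C s x)"

definition fully_invariant :: "('o, 'm, 'z) cat_data_scheme \<Rightarrow> 'o \<Rightarrow> 'm \<Rightarrow> bool" where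
  "fully_invariant C M k \<longleftrightarrow> subobject C M k \<and>
     (\<forall>h \<in> Hom C M M. \<exists>\<alpha> \<in> Hom C (Dom C k) (Dom C k). h \<cdot>\<^bsub>C\<^esub> k = k \<cdot>\<^bsub>C\<^esub> \<alpha>)"

definition direct_summand :: "('o, 'm, 'z) preadd_data_scheme \<Rightarrow> 'o \<Rightarrow> 'm \<Rightarrow> bool" where
  "direct_summand C M k \<longleftrightarrow> subobject C M k \<and>
     (\<exists>B j p q. is_biproduct C (Dom C k) B M k j p q)"

definition weak_duo :: "('o, 'm, 'z) preadd_data_scheme \<Rightarrow> 'o \<Rightarrow> bool" where
  "weak_duo C M \<longleftrightarrow> (\<forall>k. direct_summand C M k \<longrightarrow> fully_invariant C M k)"

definition essential :: "('o, 'm, 'z) cat_data_scheme \<Rightarrow> 'o \<Rightarrow> 'm \<Rightarrow> bool" where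
  "essential C L k \<longleftrightarrow> subobject C L k \<and>
     (\<forall>x z. subobject C L x \<and> is_intersection C L {k, x} (\<lambda>y. y) z \<and> is_zero_object C (Dom C z)
        \<longrightarrow> is_zero_object C (Dom C x))"

text \<open>The identity of \<open>L\<close> represents \<open>L\<close> as a subobject of itself, and so does any isomorphism.\<close>

definition superfluous :: "('o, 'm, 'z) cat_data_scheme \<Rightarrow> 'o \<Rightarrow> 'm \<Rightarrow> bool" where
  "superfluous C L k \<longleftrightarrow> subobject C L k \<and>
     (\<forall>x. subobject C L x \<and> is_sum C L {k, x} (\<lambda>y. y) (Ident C L) \<longrightarrow> is_iso C x)"

text \<open>For subobjects \<open>k\<close> and \<open>d\<close> of the same object, \<open>k \<subseteq> d\<close> and \<open>k\<close> is essential in \<open>d\<close>.\<close>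

definition essential_in :: "('o, 'm, 'z) cat_data_scheme \<Rightarrow> 'm \<Rightarrow> 'm \<Rightarrow> bool" where
  "essential_in C k d \<longleftrightarrow>
     (\<exists>h \<in> Hom C (Dom C k) (Dom C d). k = d \<cdot>\<^bsub>C\<^esub> h \<and> essential C (Dom C d) h)"

text \<open>
  For subobjects \<open>l: L \<rightarrow> M\<close> and \<open>d: K \<rightarrow> M\<close>: \<open>h\<close> is the inclusion \<open>K \<subseteq> L\<close>, the quotients are
  \<open>p: M \<rightarrow> M/K\<close> and \<open>q: L \<rightarrow> L/K\<close>, and \<open>u: L/K \<rightarrow> M/K\<close> is the induced monomorphism.
\<close>

definition lies_above :: "('o, 'm, 'z) preadd_data_scheme \<Rightarrow> 'm \<Rightarrow> 'm \<Rightarrow> bool" where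
  "lies_above C l d \<longleftrightarrow>
     (\<exists>h \<in> Hom C (Dom C d) (Dom C l). d = l \<cdot>\<^bsub>C\<^esub> h \<and>
       (\<exists>p q. is_cokernel C d p \<and> is_cokernel C h q \<and>
         (\<exists>u \<in> Hom C (Cod C q) (Cod C p). u \<cdot>\<^bsub>C\<^esub> q = p \<cdot>\<^bsub>C\<^esub> l \<and> superfluous C (Cod C p) u)))"


section \<open>CS-Baer objects\<close>

definition self_CS_Baer :: "('o, 'm, 'z) preadd_data_scheme \<Rightarrow> 'i itself \<Rightarrow> 'o \<Rightarrow> bool" where
  "self_CS_Baer C (_ :: 'i itself) M \<longleftrightarrow>
     (\<forall>(I :: 'i set) f. (\<forall>i\<in>I. f i \<in> Hom C M M) \<longrightarrow>
        (\<exists>\<kappa> k. (\<forall>i\<in>I. is_kernel C (f i) (\<kappa> i)) \<and> is_intersection C M I \<kappa> k \<and>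
           (\<exists>d. direct_summand C M d \<and> essential_in C k d)))"

definition strongly_self_CS_Baer :: "('o, 'm, 'z) preadd_data_scheme \<Rightarrow> 'i itself \<Rightarrow> 'o \<Rightarrow> bool" where
  "strongly_self_CS_Baer C (_ :: 'i itself) M \<longleftrightarrow>
     (\<forall>(I :: 'i set) f. (\<forall>i\<in>I. f i \<in> Hom C M M) \<longrightarrow>
        (\<exists>\<kappa> k. (\<forall>i\<in>I. is_kernel C (f i) (\<kappa> i)) \<and> is_intersection C M I \<kappa> k \<and>
           (\<exists>d. direct_summand C M d \<and> fully_invariant C M d \<and> essential_in C k d)))"

definition dual_self_CS_Baer :: "('o, 'm, 'z) preadd_data_scheme \<Rightarrow> 'i itself \<Rightarrow> 'o \<Rightarrow> bool" where
  "dual_self_CS_Baer C (_ :: 'i itself) M \<longleftrightarrow>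
     (\<forall>(I :: 'i set) f. (\<forall>i\<in>I. f i \<in> Hom C M M) \<longrightarrow>
        (\<exists>\<mu> s. (\<forall>i\<in>I. is_image C (f i) (\<mu> i)) \<and> is_sum C M I \<mu> s \<and>
           (\<exists>d. direct_summand C M d \<and> lies_above C s d)))"

definition dual_strongly_self_CS_Baer :: "('o, 'm, 'z) preadd_data_scheme \<Rightarrow> 'i itself \<Rightarrow> 'o \<Rightarrow> bool" where
  "dual_strongly_self_CS_Baer C (_ :: 'i itself) M \<longleftrightarrow>
     (\<forall>(I :: 'i set) f. (\<forall>i\<in>I. f i \<in> Hom C M M) \<longrightarrow>
        (\<exists>\<mu> s. (\<forall>i\<in>I. is_image C (f i) (\<mu> i)) \<and> is_sum C M I \<mu> s \<and>
           (\<exists>d. direct_summand C M d \<and> fully_invariant C M d \<and> lies_above C s d)))"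


section \<open>Endomorphism rings\<close>

definition End_ring :: "('o, 'm, 'z) preadd_data_scheme \<Rightarrow> 'o \<Rightarrow> 'm ring" where
  "End_ring C M = \<lparr>carrier = Hom C M M, mult = Comp C, one = Ident C M,
     zero = Zero C M M, add = Add C\<rparr>"

locale abelian_ring = ring R for R (structure) +
  assumes idempotents_central:
    "\<lbrakk>e \<in> carrier R; e \<otimes> e = e; x \<in> carrier R\<rbrakk> \<Longrightarrow> e \<otimes> x = x \<otimes> e"

end

theory Submission
  imports Defs
begin

text \<open>
  A direct summand of \<open>M\<close> is the kernel and the image of an idempotent endomorphism. If it is essential
  in a larger subobject, or lies above a smaller direct summand, then the two coincide, because the
  inclusion splits and a split essential (superfluous) subobject is everything (zero). Hence
  the strong conditions, applied to a single idempotent, make every direct summand fully invariant.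
  Idempotents split, and \<open>e\<close> with complement \<open>e'\<close> commutes with \<open>h\<close> if and only if
  \<open>e \<cdot> h \<cdot> e = h \<cdot> e\<close> and \<open>e' \<cdot> h \<cdot> e' = h \<cdot> e'\<close>, that is, if the images of \<open>e\<close> and \<open>e'\<close>
  are \<open>h\<close>-invariant.
\<close>

section \<open>Monomorphisms, subobjects and zero objects\<close>

lemma HomD:
  assumes "f \<in> Hom C A B"
  shows "f \<in> Arr C" "Dom C f = A" "Cod C f = B"
  using assms by (auto simp: Hom_def)

context category
begin

lemma Hom_Obj: "f \<in> Hom C A B \<Longrightarrow> A \<in> Obj C \<and> B \<in> Obj C"
  using Dom_in_Obj Cod_in_Obj by (auto simp: Hom_def)

lemma is_monoD:
  assumes "is_mono C m" "m \<in> Hom C A B" "x \<in> Hom C X A" "y \<in> Hom C X A" "m \<cdot> x = m \<cdot> y"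
  shows "x = y"
  using assms Hom_Obj[OF assms(3)] HomD[OF assms(2)] by (auto simp: is_mono_def)

lemma is_monoI:
  assumes "m \<in> Hom C A B"
    and "\<And>X x y. x \<in> Hom C X A \<Longrightarrow> y \<in> Hom C X A \<Longrightarrow> m \<cdot> x = m \<cdot> y \<Longrightarrow> x = y"
  shows "is_mono C m"
  using assms HomD[OF assms(1)] by (auto simp: is_mono_def)

lemma split_mono:
  assumes m: "m \<in> Hom C A B" and r: "r \<in> Hom C B A" and rm: "r \<cdot> m = Ident C A"
  shows "is_mono C m"
proof (rule is_monoI[OF m])
  fix X x y assume x: "x \<in> Hom C X A" and y: "y \<in> Hom C X A" and eq: "m \<cdot> x = m \<cdot> y"
  have "x = (r \<cdot> m) \<cdot> x" using Ident_Comp[OF x] rm by simp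
  also have "\<dots> = (r \<cdot> m) \<cdot> y" using Comp_assoc[OF x m r] Comp_assoc[OF y m r] eq by simp
  also have "\<dots> = y" using Ident_Comp[OF y] rm by simp
  finally show "x = y" .
qed

lemma subobject_Hom: "subobject C M k \<Longrightarrow> k \<in> Hom C (Dom C k) M"
  by (auto simp: subobject_def is_mono_def Hom_def)

lemma sub_leI: "k = l \<cdot> h \<Longrightarrow> k \<in> Hom C A M \<Longrightarrow> l \<in> Hom C B M \<Longrightarrow> h \<in> Hom C A B \<Longrightarrow> sub_le C k l"
  by (auto simp: sub_le_def Hom_def)

lemma sub_le_refl: "subobject C M k \<Longrightarrow> sub_le C k k"
  using Comp_Ident[OF subobject_Hom] Ident_in_Hom Hom_Obj[OF subobject_Hom]
  by (metis sub_le_def)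

lemma sub_leD:
  assumes "sub_le C k l" "k \<in> Hom C A M" "l \<in> Hom C B M"
  obtains h where "h \<in> Hom C A B" "k = l \<cdot> h"
  using assms HomD(2)[OF assms(2)] HomD(2)[OF assms(3)] by (auto simp: sub_le_def)

lemma sub_le_trans:
  assumes "sub_le C k l" "sub_le C l m" "k \<in> Hom C A M" "l \<in> Hom C B M" "m \<in> Hom C D M"
  shows "sub_le C k m"
proof -
  obtain h where h: "h \<in> Hom C A B" "k = l \<cdot> h" using sub_leD assms by metis
  obtain g where g: "g \<in> Hom C B D" "l = m \<cdot> g" using sub_leD assms by metis
  show ?thesis
    using sub_leI[OF _ assms(3,5) Comp_in_Hom[OF h(1) g(1)]] Comp_assoc[OF h(1) g(1) assms(5)] h g
    by simp
qed

text \<open>The endomorphism induced on the domain of \<open>d'\<close> is carried along the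
  comparison maps \<open>a\<close> and \<open>b\<close>, so full invariance belongs to the subobject
  and not to the monomorphism representing it.\<close>

lemma fully_invariant_cong:
  assumes d': "fully_invariant C M d'" and d: "subobject C M d"
    and le: "sub_le C d d'" and ge: "sub_le C d' d"
  shows "fully_invariant C M d"
  unfolding fully_invariant_def
proof (intro conjI ballI d)
  let ?K = "Dom C d" and ?K' = "Dom C d'"
  have d'M: "d' \<in> Hom C ?K' M" using d' subobject_Hom by (auto simp: fully_invariant_def)
  have dM: "d \<in> Hom C ?K M" using d subobject_Hom by auto
  obtain a where a: "a \<in> Hom C ?K ?K'" "d = d' \<cdot> a" using sub_leD[OF le dM d'M] .
  obtain b where b: "b \<in> Hom C ?K' ?K" "d' = d \<cdot> b" using sub_leD[OF ge d'M dM] .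
  fix h assume h: "h \<in> Hom C M M"
  then obtain \<alpha> where \<alpha>: "\<alpha> \<in> Hom C ?K' ?K'" "h \<cdot> d' = d' \<cdot> \<alpha>"
    using d' by (auto simp: fully_invariant_def)
  have \<alpha>a: "\<alpha> \<cdot> a \<in> Hom C ?K ?K'" using Comp_in_Hom a \<alpha> by blast
  have "h \<cdot> d = (h \<cdot> d') \<cdot> a" using Comp_assoc[OF a(1) d'M h] a by simp
  also have "\<dots> = d' \<cdot> (\<alpha> \<cdot> a)" using Comp_assoc[OF a(1) \<alpha>(1) d'M] \<alpha> by simp
  also have "\<dots> = d \<cdot> (b \<cdot> (\<alpha> \<cdot> a))" using Comp_assoc[OF \<alpha>a b(1) dM] b by simp
  finally show "\<exists>\<alpha>\<in>Hom C ?K ?K. h \<cdot> d = d \<cdot> \<alpha>" using Comp_in_Hom[OF \<alpha>a b(1)] by blast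
qed

lemma intersection_singleton:
  assumes "is_intersection C M {i} \<kappa> k"
  shows "sub_le C k (\<kappa> i)" "sub_le C (\<kappa> i) k"
  using assms sub_le_refl by (auto simp: is_intersection_def)

lemma sum_singleton:
  assumes "is_sum C M {i} \<mu> s"
  shows "sub_le C s (\<mu> i)" "sub_le C (\<mu> i) s"
  using assms sub_le_refl by (auto simp: is_sum_def)

lemma zero_object_unique:
  assumes "is_zero_object C Z"
  shows "x \<in> Hom C X Z \<Longrightarrow> y \<in> Hom C X Z \<Longrightarrow> x = y"
    and "x \<in> Hom C Z X \<Longrightarrow> y \<in> Hom C Z X \<Longrightarrow> x = y"
  using assms Hom_Obj unfolding is_zero_object_def by blast+

end

section \<open>Hom groups and the endomorphism ring\<close>

context preadditive_category
begin

lemma Zero_in_Hom: "A \<in> Obj C \<Longrightarrow> B \<in> Obj C \<Longrightarrow> Zero C A B \<in> Hom C A B"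
  using comm_group.axioms(1)[OF Hom_comm_group] monoid.one_closed[of "Hom_group C A B"]
  by (simp add: Hom_group_def comm_monoid.axioms(1))

lemma Add_in_Hom:
  assumes "f \<in> Hom C A B" "g \<in> Hom C A B"
  shows "f \<boxplus> g \<in> Hom C A B"
proof -
  interpret comm_group "Hom_group C A B" using Hom_comm_group Hom_Obj[OF assms(1)] by blast
  show ?thesis using m_closed[of f g] assms by (simp add: Hom_group_def)
qed

lemma Add_comm:
  assumes "f \<in> Hom C A B" "g \<in> Hom C A B"
  shows "f \<boxplus> g = g \<boxplus> f"
proof -
  interpret comm_group "Hom_group C A B" using Hom_comm_group Hom_Obj[OF assms(1)] by blast
  show ?thesis using m_comm[of f g] assms by (simp add: Hom_group_def)
qed

lemma Add_assoc:
  assumes "f \<in> Hom C A B" "g \<in> Hom C A B" "h \<in> Hom C A B"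
  shows "(f \<boxplus> g) \<boxplus> h = f \<boxplus> (g \<boxplus> h)"
proof -
  interpret comm_group "Hom_group C A B" using Hom_comm_group Hom_Obj[OF assms(1)] by blast
  show ?thesis using m_assoc[of f g h] assms by (simp add: Hom_group_def)
qed

lemma Zero_Add:
  assumes "f \<in> Hom C A B"
  shows "Zero C A B \<boxplus> f = f"
proof -
  interpret comm_group "Hom_group C A B" using Hom_comm_group Hom_Obj[OF assms] by blast
  show ?thesis using l_one[of f] assms by (simp add: Hom_group_def)
qed

lemma Add_Zero: "f \<in> Hom C A B \<Longrightarrow> f \<boxplus> Zero C A B = f"
  using Zero_Add Add_comm Zero_in_Hom Hom_Obj by metis

lemma Add_eq_self:
  assumes "f \<in> Hom C A B" "g \<in> Hom C A B" "f \<boxplus> g = f"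
  shows "g = Zero C A B"
proof -
  interpret comm_group "Hom_group C A B" using Hom_comm_group Hom_Obj[OF assms(1)] by blast
  show ?thesis using r_cancel_one[of f g] assms Add_comm[OF assms(1,2)] by (simp add: Hom_group_def)
qed

text \<open>The category data contain no negation, so \<open>g - f\<close> enters as a solution of
  this equation. It supplies negatives in the endomorphism ring and complements such as
  \<open>1 - e\<close>.\<close>

lemma Add_complement:
  assumes "f \<in> Hom C A B" "g \<in> Hom C A B"
  obtains h where "h \<in> Hom C A B" "f \<boxplus> h = g"
proof -
  interpret comm_group "Hom_group C A B" using Hom_comm_group Hom_Obj[OF assms(1)] by blast
  let ?G = "Hom_group C A B"
  have f: "f \<in> carrier ?G" and g: "g \<in> carrier ?G" using assms by (auto simp: Hom_group_def)
  have "f \<otimes>\<^bsub>?G\<^esub> (inv\<^bsub>?G\<^esub> f \<otimes>\<^bsub>?G\<^esub> g) = g" using f g by (simp add: m_assoc[symmetric])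
  moreover have "inv\<^bsub>?G\<^esub> f \<otimes>\<^bsub>?G\<^esub> g \<in> carrier ?G" using f g by simp
  ultimately show thesis using that by (simp add: Hom_group_def)
qed

lemma Comp_Zero:
  assumes g: "g \<in> Hom C B D" and A: "A \<in> Obj C"
  shows "g \<cdot> Zero C A B = Zero C A D"
proof -
  have z: "Zero C A B \<in> Hom C A B" using Zero_in_Hom A Hom_Obj[OF g] by blast
  \<comment> \<open>An element of a group that equals its own double is zero.\<close>
  have "g \<cdot> Zero C A B \<boxplus> g \<cdot> Zero C A B = g \<cdot> Zero C A B"
    using Comp_Add[OF z z g] Zero_Add[OF z] by simp
  then show ?thesis using Add_eq_self Comp_in_Hom[OF z g] by blast
qed

lemma Zero_Comp:
  assumes f: "f \<in> Hom C A B" and D: "D \<in> Obj C"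
  shows "Zero C B D \<cdot> f = Zero C A D"
proof -
  have z: "Zero C B D \<in> Hom C B D" using Zero_in_Hom D Hom_Obj[OF f] by blast
  have "Zero C B D \<cdot> f \<boxplus> Zero C B D \<cdot> f = Zero C B D \<cdot> f"
    using Add_Comp[OF f z z] Zero_Add[OF z] by simp
  then show ?thesis using Add_eq_self Comp_in_Hom[OF f z] by blast
qed

text \<open>The locale \<open>abelian_ring\<close> extends \<open>ring\<close>, so the ring axioms
  are due along with the centrality of idempotents.\<close>

lemma ring_End_ring:
  assumes M: "M \<in> Obj C"
  shows "ring (End_ring C M)"
proof (rule ringI)
  show "abelian_group (End_ring C M)"
  proof (rule abelian_groupI)
    fix x assume x: "x \<in> carrier (End_ring C M)"
    then obtain y where y: "y \<in> Hom C M M" "x \<boxplus> y = Zero C M M"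
      using Add_complement[OF _ Zero_in_Hom[OF M M], of x] by (auto simp: End_ring_def)
    then show "\<exists>y\<in>carrier (End_ring C M). y \<oplus>\<^bsub>End_ring C M\<^esub> x = \<zero>\<^bsub>End_ring C M\<^esub>"
      using x Add_comm by (fastforce simp: End_ring_def)
  qed (use M in \<open>auto simp: End_ring_def Add_in_Hom Zero_in_Hom Zero_Add
      intro: Add_assoc Add_comm\<close>)
  show "Group.monoid (End_ring C M)"
    by (rule monoidI) (use M in \<open>auto simp: End_ring_def Ident_in_Hom Comp_Ident Ident_Comp
      intro: Comp_in_Hom Comp_assoc\<close>)
qed (auto simp: End_ring_def intro: Add_Comp Comp_Add)

section \<open>Kernels and cokernels\<close>

lemma is_kernel_Hom:
  assumes "is_kernel C f k" "f \<in> Hom C A B"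
  shows "k \<in> Hom C (Dom C k) A" "f \<cdot> k = Zero C (Dom C k) B"
  using assms HomD[OF assms(2)] by (auto simp: is_kernel_def Hom_def)

lemma is_kernel_factor:
  assumes "is_kernel C f k" "f \<in> Hom C A B" "x \<in> Hom C X A" "f \<cdot> x = Zero C X B"
  obtains y where "y \<in> Hom C X (Dom C k)" "k \<cdot> y = x"
  using assms HomD[OF assms(2)] Hom_Obj[OF assms(3)] unfolding is_kernel_def by blast

lemma is_kernel_mono:
  assumes k: "is_kernel C f k" and f: "f \<in> Hom C A B"
  shows "subobject C A k"
proof -
  note kA = is_kernel_Hom[OF k f]
  have B: "B \<in> Obj C" using Hom_Obj f by blast
  have "is_mono C k"
  proof (rule is_monoI[OF kA(1)])
    fix X x y
    assume x: "x \<in> Hom C X (Dom C k)" and y: "y \<in> Hom C X (Dom C k)" and eq: "k \<cdot> x = k \<cdot> y"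
    have "f \<cdot> (k \<cdot> x) = Zero C X B" using Comp_assoc[OF x kA(1) f] kA(2) Zero_Comp[OF x B] by simp
    \<comment> \<open>Both \<open>x\<close> and \<open>y\<close> factor the same morphism through
      \<open>k\<close>, and the universal property allows one factorization only.\<close>
    then have "\<exists>!z. z \<in> Hom C X (Dom C k) \<and> k \<cdot> z = k \<cdot> x"
      using k Comp_in_Hom[OF x kA(1)] HomD[OF f] Hom_Obj[OF x] unfolding is_kernel_def by blast
    then show "x = y" using x y eq by metis
  qed
  then show ?thesis using kA HomD by (auto simp: subobject_def)
qed

lemma is_cokernel_Hom:
  assumes "is_cokernel C f q" "f \<in> Hom C A B"
  shows "q \<in> Hom C B (Cod C q)" "q \<cdot> f = Zero C A (Cod C q)"
  using assms HomD[OF assms(2)] by (auto simp: is_cokernel_def Hom_def)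

lemma is_cokernel_factor:
  assumes "is_cokernel C f q" "f \<in> Hom C A B" "x \<in> Hom C B X" "x \<cdot> f = Zero C A X"
  obtains y where "y \<in> Hom C (Cod C q) X" "y \<cdot> q = x"
  using assms HomD[OF assms(2)] Hom_Obj[OF assms(3)] unfolding is_cokernel_def by blast

text \<open>Dual to kernels being monomorphisms: \<open>x \<cdot> q\<close> kills \<open>f\<close>,
  hence has a unique factorization through \<open>q\<close>.\<close>

lemma is_cokernel_cancel:
  assumes q: "is_cokernel C f q" and f: "f \<in> Hom C A B"
    and x: "x \<in> Hom C (Cod C q) X" and y: "y \<in> Hom C (Cod C q) X" and eq: "x \<cdot> q = y \<cdot> q"
  shows "x = y"
proof -
  note qB = is_cokernel_Hom[OF q f]
  have "(x \<cdot> q) \<cdot> f = Zero C A X"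
    using Comp_assoc[OF f qB(1) x] qB(2) Comp_Zero[OF x] Hom_Obj[OF f] by simp
  then have "\<exists>!z. z \<in> Hom C (Cod C q) X \<and> z \<cdot> q = x \<cdot> q"
    using q Comp_in_Hom[OF qB(1) x] HomD[OF f] Hom_Obj[OF x] unfolding is_cokernel_def by blast
  then show ?thesis using x y eq by metis
qed

section \<open>Biproducts and direct summands\<close>

lemma direct_summandE:
  assumes "direct_summand C M d"
  obtains B j p q where "is_biproduct C (Dom C d) B M d j p q"
  using assms by (auto simp: direct_summand_def)

text \<open>A summand contains whatever its complementary projection kills: in the decomposition of
  \<open>x\<close> by the identity of \<open>M\<close>, the component through \<open>j\<close>
  vanishes.\<close>

lemma is_biproduct_factor:
  assumes bp: "is_biproduct C K B M d j p q" and x: "x \<in> Hom C X M" and qx: "q \<cdot> x = Zero C X B"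
  shows "x = d \<cdot> (p \<cdot> x)"
proof -
  have h: "d \<in> Hom C K M" "j \<in> Hom C B M" "p \<in> Hom C M K" "q \<in> Hom C M B"
    "(d \<cdot> p) \<boxplus> (j \<cdot> q) = Ident C M"
    using bp by (auto simp: is_biproduct_def)
  have "x = ((d \<cdot> p) \<boxplus> (j \<cdot> q)) \<cdot> x" using h Ident_Comp[OF x] by simp
  also have "\<dots> = d \<cdot> (p \<cdot> x) \<boxplus> j \<cdot> (q \<cdot> x)"
    using Add_Comp[OF x Comp_in_Hom[OF h(3,1)] Comp_in_Hom[OF h(4,2)]]
      Comp_assoc[OF x h(3,1)] Comp_assoc[OF x h(4,2)] by simp
  also have "j \<cdot> (q \<cdot> x) = Zero C X M" using qx Comp_Zero[OF h(2)] Hom_Obj[OF x] by simp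
  finally show ?thesis
    using Add_Zero[OF Comp_in_Hom[OF Comp_in_Hom[OF x h(3)] h(1)]] by simp
qed

text \<open>The idempotent \<open>d \<cdot> p\<close> fixes \<open>d\<close> and commutes with
  \<open>g\<close>, so \<open>g \<cdot> d\<close> is unchanged by \<open>d \<cdot> p\<close> and
  therefore factors through \<open>d\<close>.\<close>

lemma direct_summand_fully_invariant:
  assumes ab: "abelian_ring (End_ring C M)" and d: "direct_summand C M d"
  shows "fully_invariant C M d"
  unfolding fully_invariant_def
proof (intro conjI ballI)
  show "subobject C M d" using d by (simp add: direct_summand_def)
  let ?K = "Dom C d"
  obtain B j p q where bp: "is_biproduct C ?K B M d j p q" using direct_summandE[OF d] .
  have h: "d \<in> Hom C ?K M" "p \<in> Hom C M ?K" "p \<cdot> d = Ident C ?K"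
    using bp by (auto simp: is_biproduct_def)
  fix g assume g: "g \<in> Hom C M M"
  have e: "d \<cdot> p \<in> Hom C M M" using Comp_in_Hom h by blast
  have ed: "(d \<cdot> p) \<cdot> d = d" using Comp_assoc[OF h(1,2,1)] h Comp_Ident by simp
  then have "(d \<cdot> p) \<cdot> (d \<cdot> p) = d \<cdot> p" using Comp_assoc[OF h(2,1) e] by simp
  then have c: "(d \<cdot> p) \<cdot> g = g \<cdot> (d \<cdot> p)"
    using abelian_ring.idempotents_central[OF ab, of "d \<cdot> p" g] e g by (simp add: End_ring_def)
  have gd: "g \<cdot> d \<in> Hom C ?K M" using Comp_in_Hom[OF h(1) g] .
  have "g \<cdot> d = (g \<cdot> (d \<cdot> p)) \<cdot> d" using Comp_assoc[OF h(1) e g] ed by simp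
  also have "\<dots> = (d \<cdot> p) \<cdot> (g \<cdot> d)" using c Comp_assoc[OF h(1) g e] by simp
  also have "\<dots> = d \<cdot> (p \<cdot> (g \<cdot> d))" using Comp_assoc[OF gd h(2,1)] .
  finally show "\<exists>\<alpha>\<in>Hom C ?K ?K. g \<cdot> d = d \<cdot> \<alpha>" using Comp_in_Hom[OF gd h(2)] by blast
qed

end

section \<open>Splitting of idempotents, and weak duo objects versus central idempotents\<close>

context abelian_category
begin

text \<open>Each idempotent splits through the kernel of the other one, and the two splittings form
  a biproduct. Idempotency is encoded in the sum and orthogonality equations.\<close>

lemma split_complementary_idempotents:
  assumes M: "M \<in> Obj C" and e: "e \<in> Hom C M M" and e': "e' \<in> Hom C M M"
    and sum: "e \<boxplus> e' = Ident C M" and orth: "e \<cdot> e' = Zero C M M" "e' \<cdot> e = Zero C M M"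
  obtains K B k j p q where "is_biproduct C K B M k j p q" "k \<cdot> p = e"
proof -
  \<comment> \<open>One half of the biproduct, stated for an arbitrary pair so that it also applies
    with \<open>e\<close> and \<open>e'\<close> exchanged.\<close>
  have split: "\<exists>K k p. is_kernel C e' k \<and> k \<in> Hom C K M \<and> p \<in> Hom C M K \<and> k \<cdot> p = e \<and> p \<cdot> k = Ident C K"
    if e: "e \<in> Hom C M M" and e': "e' \<in> Hom C M M" and sum: "e \<boxplus> e' = Ident C M"
      and orth: "e' \<cdot> e = Zero C M M" for e e'
  proof -
    obtain k where k: "is_kernel C e' k" using kernels HomD[OF e'] by blast
    let ?K = "Dom C k"
    note kM = is_kernel_Hom[OF k e']
    \<comment> \<open>On the kernel of \<open>e'\<close> the equation \<open>e + e' = 1\<close> says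
      that \<open>e\<close> is the identity.\<close>
    have ek: "e \<cdot> k = k"
      using Add_Comp[OF kM(1) e e'] sum Ident_Comp[OF kM(1)] kM(2)
        Add_Zero[OF Comp_in_Hom[OF kM(1) e]] by simp
    obtain p where p: "p \<in> Hom C M ?K" "k \<cdot> p = e" using is_kernel_factor[OF k e' e orth] .
    have K: "?K \<in> Obj C" using Hom_Obj kM by blast
    have "k \<cdot> (p \<cdot> k) = k \<cdot> Ident C ?K"
      using Comp_assoc[OF kM(1) p(1) kM(1)] p ek Comp_Ident[OF kM(1)] by simp
    then have "p \<cdot> k = Ident C ?K"
      using is_monoD is_kernel_mono[OF k e'] kM Comp_in_Hom[OF kM(1) p(1)] Ident_in_Hom[OF K]
      unfolding subobject_def by blast
    then show ?thesis using k kM p by blast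
  qed
  obtain K k p where k: "is_kernel C e' k" "k \<in> Hom C K M" "p \<in> Hom C M K" "k \<cdot> p = e" "p \<cdot> k = Ident C K"
    using split[OF e e' sum orth(2)] by blast
  obtain B j q where j: "is_kernel C e j" "j \<in> Hom C B M" "q \<in> Hom C M B" "j \<cdot> q = e'" "q \<cdot> j = Ident C B"
    using split[OF e' e _ orth(1)] sum Add_comm[OF e e'] by auto
  have pj': "p \<cdot> j \<in> Hom C B K" using Comp_in_Hom j(2) k(3) by blast
  \<comment> \<open>Inserting \<open>p \<cdot> k = 1\<close> makes \<open>e = k \<cdot> p\<close>
    appear next to \<open>j\<close>, and \<open>j\<close> is a kernel of \<open>e\<close>. The other
    mixed composite is treated alike.\<close>
  have "p \<cdot> j = (p \<cdot> k) \<cdot> (p \<cdot> j)" using k(5) Ident_Comp[OF pj'] by simp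
  also have "\<dots> = p \<cdot> (e \<cdot> j)"
    using Comp_assoc[OF pj' k(2,3)] Comp_assoc[OF j(2) k(3,2)] k(4) by simp
  also have "\<dots> = Zero C B K"
    using is_kernel_Hom(2)[OF j(1) e] HomD[OF j(2)] Comp_Zero[OF k(3)] Hom_Obj[OF j(2)] by simp
  finally have pj: "p \<cdot> j = Zero C B K" .
  have qk': "q \<cdot> k \<in> Hom C K B" using Comp_in_Hom k(2) j(3) by blast
  have "q \<cdot> k = (q \<cdot> j) \<cdot> (q \<cdot> k)" using j(5) Ident_Comp[OF qk'] by simp
  also have "\<dots> = q \<cdot> (e' \<cdot> k)"
    using Comp_assoc[OF qk' j(2,3)] Comp_assoc[OF k(2) j(3,2)] j(4) by simp
  also have "\<dots> = Zero C K B"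
    using is_kernel_Hom(2)[OF k(1) e'] HomD[OF k(2)] Comp_Zero[OF j(3)] Hom_Obj[OF k(2)] by simp
  finally have qk: "q \<cdot> k = Zero C K B" .
  have "is_biproduct C K B M k j p q" using k j pj qk sum by (simp add: is_biproduct_def)
  then show thesis using that k by blast
qed

text \<open>The equation expresses \<open>h\<close>-invariance of the image of \<open>e\<close>.
  That image \<open>k\<close> is a direct summand, so \<open>h \<cdot> e\<close> factors through
  \<open>k\<close>, on which \<open>e\<close> acts as the identity.\<close>

lemma weak_duo_idempotent:
  assumes wd: "weak_duo C M" and M: "M \<in> Obj C" and e: "e \<in> Hom C M M" and e': "e' \<in> Hom C M M"
    and sum: "e \<boxplus> e' = Ident C M" and orth: "e \<cdot> e' = Zero C M M" "e' \<cdot> e = Zero C M M"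
    and h: "h \<in> Hom C M M"
  shows "e \<cdot> (h \<cdot> e) = h \<cdot> e"
proof -
  obtain K B k j p q where bp: "is_biproduct C K B M k j p q" and kp: "k \<cdot> p = e"
    using split_complementary_idempotents[OF M e e' sum orth] .
  have k: "k \<in> Hom C K M" "p \<in> Hom C M K" "p \<cdot> k = Ident C K" "Dom C k = K"
    using bp by (auto simp: is_biproduct_def Hom_def)
  have "subobject C M k" using split_mono[OF k(1-3)] HomD[OF k(1)] by (simp add: subobject_def)
  then have "direct_summand C M k" using bp k by (auto simp: direct_summand_def)
  then have "fully_invariant C M k" using wd by (simp add: weak_duo_def)
  then obtain \<alpha> where \<alpha>: "\<alpha> \<in> Hom C K K" "h \<cdot> k = k \<cdot> \<alpha>"
    using h k(4) by (auto simp: fully_invariant_def)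
  have ek: "e \<cdot> k = k" using kp Comp_assoc[OF k(1,2,1)] k Comp_Ident[OF k(1)] by simp
  have \<alpha>p: "\<alpha> \<cdot> p \<in> Hom C M K" using Comp_in_Hom k \<alpha> by blast
  have he: "h \<cdot> e = k \<cdot> (\<alpha> \<cdot> p)"
    using kp Comp_assoc[OF k(2,1) h] \<alpha> Comp_assoc[OF k(2) \<alpha>(1) k(1)] by simp
  then show ?thesis using ek Comp_assoc[OF \<alpha>p k(1) e] by simp
qed

lemma weak_duo_iff_abelian_End:
  assumes M: "M \<in> Obj C"
  shows "weak_duo C M \<longleftrightarrow> abelian_ring (End_ring C M)"
proof
  assume "abelian_ring (End_ring C M)"
  then show "weak_duo C M" using direct_summand_fully_invariant by (auto simp: weak_duo_def)
next
  assume wd: "weak_duo C M"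
  have central: "e \<cdot> h = h \<cdot> e" if e: "e \<in> Hom C M M" "e \<cdot> e = e" and h: "h \<in> Hom C M M" for e h
  proof -
    obtain e' where e': "e' \<in> Hom C M M" and sum: "e \<boxplus> e' = Ident C M"
      using Add_complement[OF e(1) Ident_in_Hom[OF M]] .
    \<comment> \<open>Multiplying \<open>e + e' = 1\<close> by \<open>e\<close> on either side and
      cancelling \<open>e\<close> gives orthogonality.\<close>
    have "e \<boxplus> e \<cdot> e' = e" using Comp_Add[OF e(1) e' e(1)] sum Comp_Ident[OF e(1)] e by simp
    then have z: "e \<cdot> e' = Zero C M M" using Add_eq_self[OF e(1) Comp_in_Hom[OF e' e(1)]] by simp
    have "e \<boxplus> e' \<cdot> e = e" using Add_Comp[OF e(1) e(1) e'] sum Ident_Comp[OF e(1)] e by simp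
    then have z': "e' \<cdot> e = Zero C M M" using Add_eq_self[OF e(1) Comp_in_Hom[OF e(1) e']] by simp
    have he: "h \<cdot> e \<in> Hom C M M" and he': "h \<cdot> e' \<in> Hom C M M" using Comp_in_Hom h e e' by blast+
    have inv: "e \<cdot> (h \<cdot> e) = h \<cdot> e"
      using weak_duo_idempotent[OF wd M e(1) e' sum z z' h] .
    have "e' \<boxplus> e = Ident C M" using sum Add_comm[OF e(1) e'] by simp
    then have inv': "e' \<cdot> (h \<cdot> e') = h \<cdot> e'"
      using weak_duo_idempotent[OF wd M e' e(1) _ z' z h] by simp
    \<comment> \<open>Invariance of the complementary image lets \<open>e'\<close> be inserted in
      front of \<open>h \<cdot> e'\<close>, where \<open>e\<close> kills it.\<close>
    have ehe': "e \<cdot> (h \<cdot> e') = Zero C M M"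
      using Comp_assoc[OF he' e' e(1)] inv' z Zero_Comp[OF he' M] by simp
    \<comment> \<open>After composing with \<open>e\<close>, the first summand becomes
      \<open>h \<cdot> e\<close> and the second one zero.\<close>
    have "h = h \<cdot> e \<boxplus> h \<cdot> e'" using Comp_Add[OF e(1) e' h] sum Comp_Ident[OF h] by simp
    then have "e \<cdot> h = e \<cdot> (h \<cdot> e) \<boxplus> e \<cdot> (h \<cdot> e')" using Comp_Add[OF he he' e(1)] by metis
    then show ?thesis using inv ehe' Add_Zero[OF he] by simp
  qed
  show "abelian_ring (End_ring C M)"
    using ring_End_ring[OF M] central
    by (auto simp: abelian_ring_def abelian_ring_axioms_def End_ring_def)
qed

lemma split_essential_iso:
  assumes ess: "essential C L h" and r: "r \<in> Hom C L (Dom C h)"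
    and rh: "r \<cdot> h = Ident C (Dom C h)"
  shows "h \<cdot> r = Ident C L"
proof -
  let ?K = "Dom C h"
  have h: "h \<in> Hom C ?K L" and hsub: "subobject C L h"
    using ess subobject_Hom by (auto simp: essential_def)
  have L: "L \<in> Obj C" and K: "?K \<in> Obj C" using Hom_Obj h by auto
  \<comment> \<open>The kernel of the retraction is a complement of \<open>h\<close>. It meets
    \<open>h\<close> in zero, so essentiality will force its domain to be zero.\<close>
  obtain x where x: "is_kernel C r x" using kernels HomD[OF r] by blast
  let ?X = "Dom C x"
  note xL = is_kernel_Hom[OF x r]
  have xsub: "subobject C L x" using is_kernel_mono[OF x r] .
  obtain Z where Z: "is_zero_object C Z" using zero_object by blast
  have ZO: "Z \<in> Obj C" using Z by (simp add: is_zero_object_def)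
  \<comment> \<open>The zero subobject as an actual monomorphism; it is mono because parallel
    morphisms into a zero object agree.\<close>
  define z where "z = Zero C Z L"
  have z: "z \<in> Hom C Z L" using Zero_in_Hom ZO L z_def by blast
  have "is_mono C z" using is_monoI[OF z] zero_object_unique(1)[OF Z] by blast
  then have zsub: "subobject C L z" using HomD[OF z] by (simp add: subobject_def)
  have zle: "sub_le C z y" if y: "y \<in> Hom C Y L" for y Y
    using sub_leI[OF _ z y, of "Zero C Z Y"] Comp_Zero[OF y ZO] Zero_in_Hom[OF ZO] Hom_Obj[OF y] z_def
    by auto
  \<comment> \<open>For \<open>y\<close> below both, the factor through \<open>h\<close> is
    recovered as \<open>r \<cdot> y\<close>, which vanishes since \<open>y\<close> factors through
    the kernel of \<open>r\<close>.\<close>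
  have "sub_le C y z" if ysub: "subobject C L y" and yh: "sub_le C y h" and yx: "sub_le C y x" for y
  proof -
    let ?Y = "Dom C y"
    have y: "y \<in> Hom C ?Y L" using subobject_Hom ysub by blast
    have Y: "?Y \<in> Obj C" using Hom_Obj y by blast
    obtain a where a: "a \<in> Hom C ?Y ?K" "y = h \<cdot> a" using sub_leD[OF yh y h] .
    obtain b where b: "b \<in> Hom C ?Y ?X" "y = x \<cdot> b" using sub_leD[OF yx y xL(1)] .
    have "a = r \<cdot> y" using Comp_assoc[OF a(1) h r] rh a Ident_Comp[OF a(1)] by simp
    also have "\<dots> = Zero C ?Y ?K" using Comp_assoc[OF b(1) xL(1) r] xL(2) b Zero_Comp[OF b(1) K] by simp
    finally have "y = Zero C ?Y L" using a Comp_Zero[OF h Y] by simp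
    then have "y = z \<cdot> Zero C ?Y Z" using Comp_Zero[OF z Y] by simp
    then show ?thesis using sub_leI[OF _ y z] Zero_in_Hom[OF Y ZO] by blast
  qed
  then have "is_intersection C L {h, x} (\<lambda>y. y) z"
    using hsub xsub zsub zle[OF h] zle[OF xL(1)] by (auto simp: is_intersection_def)
  then have X0: "is_zero_object C ?X"
    using ess xsub Z HomD[OF z] unfolding essential_def by auto
  \<comment> \<open>Here \<open>g\<close> is \<open>1 - h \<cdot> r\<close>. It is killed by
    \<open>r\<close>, so it factors through \<open>x\<close>, which is now a zero morphism.\<close>
  obtain g where g: "g \<in> Hom C L L" "h \<cdot> r \<boxplus> g = Ident C L"
    using Add_complement[OF Comp_in_Hom[OF r h] Ident_in_Hom[OF L]] .
  have "r \<boxplus> r \<cdot> g = r"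
    using Comp_Add[OF Comp_in_Hom[OF r h] g(1) r] g(2) Comp_assoc[OF r h r] rh
      Ident_Comp[OF r] Comp_Ident[OF r] by simp
  then have "r \<cdot> g = Zero C L ?K" using Add_eq_self[OF r Comp_in_Hom[OF g(1) r]] by simp
  then obtain w where w: "w \<in> Hom C L ?X" "x \<cdot> w = g" using is_kernel_factor[OF x r g(1)] by blast
  have "x = Zero C ?X L"
    using zero_object_unique(2)[OF X0 xL(1)] Zero_in_Hom Hom_Obj[OF xL(1)] by blast
  then have "g = Zero C L L" using w Zero_Comp[OF w(1) L] by simp
  then show ?thesis using g(2) Add_Zero[OF Comp_in_Hom[OF r h]] by simp
qed

text \<open>The kernel \<open>x\<close> of \<open>v\<close> is a complement of \<open>u\<close>, so
  \<open>u\<close> and \<open>x\<close> together sum to \<open>L\<close> and superfluity makes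
  \<open>x\<close> an isomorphism. As \<open>v\<close> kills \<open>x\<close>, it is zero, and so is
  \<open>u = u \<cdot> v \<cdot> u\<close>.\<close>

lemma split_superfluous_zero:
  assumes sup: "superfluous C L u" and v: "v \<in> Hom C L (Dom C u)"
    and vu: "v \<cdot> u = Ident C (Dom C u)"
  shows "u = Zero C (Dom C u) L"
proof -
  let ?K = "Dom C u"
  have u: "u \<in> Hom C ?K L" and usub: "subobject C L u"
    using sup subobject_Hom by (auto simp: superfluous_def)
  have L: "L \<in> Obj C" and K: "?K \<in> Obj C" using Hom_Obj u by auto
  obtain x where x: "is_kernel C v x" using kernels HomD[OF v] by blast
  let ?X = "Dom C x"
  note xL = is_kernel_Hom[OF x v]
  have xsub: "subobject C L x" using is_kernel_mono[OF x v] .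
  have I: "Ident C L \<in> Hom C L L" using Ident_in_Hom L .
  have Isub: "subobject C L (Ident C L)"
    using split_mono[OF I I Comp_Ident[OF I]] HomD[OF I] by (simp add: subobject_def)
  obtain g where g: "g \<in> Hom C L L" "u \<cdot> v \<boxplus> g = Ident C L"
    using Add_complement[OF Comp_in_Hom[OF v u] I] .
  have "v \<boxplus> v \<cdot> g = v"
    using Comp_Add[OF Comp_in_Hom[OF v u] g(1) v] g(2) Comp_assoc[OF v u v] vu
      Ident_Comp[OF v] Comp_Ident[OF v] by simp
  then have "v \<cdot> g = Zero C L ?K" using Add_eq_self[OF v Comp_in_Hom[OF g(1) v]] by simp
  then obtain w where w: "w \<in> Hom C L ?X" "x \<cdot> w = g" using is_kernel_factor[OF x v g(1)] by blast
  have "sub_le C (Ident C L) y"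
    if ysub: "subobject C L y" and uy: "sub_le C u y" and xy: "sub_le C x y" for y
  proof -
    let ?Y = "Dom C y"
    have y: "y \<in> Hom C ?Y L" using subobject_Hom ysub by blast
    obtain a where a: "a \<in> Hom C ?K ?Y" "u = y \<cdot> a" using sub_leD[OF uy u y] .
    obtain b where b: "b \<in> Hom C ?X ?Y" "x = y \<cdot> b" using sub_leD[OF xy xL(1) y] .
    have av: "a \<cdot> v \<in> Hom C L ?Y" and bw: "b \<cdot> w \<in> Hom C L ?Y" using Comp_in_Hom a b v w by blast+
    \<comment> \<open>Both terms of \<open>1 = u \<cdot> v + x \<cdot> w\<close> factor through
      \<open>y\<close>.\<close>
    have "Ident C L = y \<cdot> (a \<cdot> v \<boxplus> b \<cdot> w)"
      using Comp_Add[OF av bw y] Comp_assoc[OF v a(1) y] Comp_assoc[OF w(1) b(1) y] a b w g by simp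
    then show ?thesis using sub_leI[OF _ I y Add_in_Hom[OF av bw]] by blast
  qed
  moreover have "sub_le C y (Ident C L)" if "y \<in> Hom C Y L" for y Y
    using sub_leI[OF _ that I that] Ident_Comp[OF that] by simp
  ultimately have "is_sum C L {u, x} (\<lambda>y. y) (Ident C L)"
    using usub xsub Isub u xL(1) by (auto simp: is_sum_def)
  then have "is_iso C x" using sup xsub unfolding superfluous_def by blast
  then obtain t where t: "t \<in> Hom C L ?X" "x \<cdot> t = Ident C L"
    using HomD[OF xL(1)] by (auto simp: is_iso_def)
  have "v = (v \<cdot> x) \<cdot> t" using Comp_assoc[OF t(1) xL(1) v] t Comp_Ident[OF v] by simp
  then have "v = Zero C L ?K" using xL(2) Zero_Comp[OF t(1) K] by simp
  then have "u \<cdot> (v \<cdot> u) = Zero C ?K L" using Zero_Comp[OF u K] Comp_Zero[OF u K] by simp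
  then show ?thesis using vu Comp_Ident[OF u] by simp
qed

section \<open>Kernels and images of projections, and comparison of split subobjects\<close>

lemma kernel_of_projection:
  assumes bp: "is_biproduct C K B M d j p q" and \<kappa>: "is_kernel C (j \<cdot> q) \<kappa>"
  shows "sub_le C d \<kappa>" "sub_le C \<kappa> d"
proof -
  have h: "d \<in> Hom C K M" "j \<in> Hom C B M" "p \<in> Hom C M K" "q \<in> Hom C M B"
    "q \<cdot> j = Ident C B" "q \<cdot> d = Zero C K B"
    using bp by (auto simp: is_biproduct_def)
  have f: "j \<cdot> q \<in> Hom C M M" using Comp_in_Hom h by blast
  note \<kappa>M = is_kernel_Hom[OF \<kappa> f]
  have "(j \<cdot> q) \<cdot> d = Zero C K M"
    using Comp_assoc[OF h(1,4,2)] h(6) Comp_Zero[OF h(2)] Hom_Obj[OF h(1)] by simp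
  then obtain y where "y \<in> Hom C K (Dom C \<kappa>)" "\<kappa> \<cdot> y = d" using is_kernel_factor[OF \<kappa> f h(1)] by blast
  then show "sub_le C d \<kappa>" using sub_leI[OF _ h(1) \<kappa>M(1)] by blast
  have q\<kappa>: "q \<cdot> \<kappa> \<in> Hom C (Dom C \<kappa>) B" using Comp_in_Hom[OF \<kappa>M(1) h(4)] .
  \<comment> \<open>Since \<open>j\<close> has the retraction \<open>q\<close>, vanishing of
    \<open>j \<cdot> q \<cdot> \<kappa>\<close> already gives vanishing of
    \<open>q \<cdot> \<kappa>\<close>.\<close>
  have "q \<cdot> \<kappa> = (q \<cdot> j) \<cdot> (q \<cdot> \<kappa>)" using h(5) Ident_Comp[OF q\<kappa>] by simp
  also have "\<dots> = q \<cdot> ((j \<cdot> q) \<cdot> \<kappa>)" using Comp_assoc[OF q\<kappa> h(2,4)] Comp_assoc[OF \<kappa>M(1) h(4,2)] by simp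
  also have "\<dots> = Zero C (Dom C \<kappa>) B" using \<kappa>M Comp_Zero[OF h(4)] Hom_Obj[OF \<kappa>M(1)] by simp
  finally have "\<kappa> = d \<cdot> (p \<cdot> \<kappa>)" using is_biproduct_factor[OF bp \<kappa>M(1)] by blast
  then show "sub_le C \<kappa> d" using sub_leI[OF _ \<kappa>M(1) h(1) Comp_in_Hom[OF \<kappa>M(1) h(3)]] by blast
qed

text \<open>The image is the kernel of a cokernel \<open>c\<close>. As
  \<open>d = (d \<cdot> p) \<cdot> d\<close>, it is killed by \<open>c\<close>. Conversely
  \<open>q\<close> kills \<open>d \<cdot> p\<close>, so it factors through \<open>c\<close> and
  kills \<open>\<mu>\<close>.\<close>

lemma image_of_projection:
  assumes bp: "is_biproduct C K B M d j p q" and \<mu>: "is_image C (d \<cdot> p) \<mu>"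
  shows "sub_le C d \<mu>" "sub_le C \<mu> d"
proof -
  have h: "d \<in> Hom C K M" "j \<in> Hom C B M" "p \<in> Hom C M K" "q \<in> Hom C M B"
    "p \<cdot> d = Ident C K" "q \<cdot> d = Zero C K B"
    using bp by (auto simp: is_biproduct_def)
  have f: "d \<cdot> p \<in> Hom C M M" using Comp_in_Hom h by blast
  have B: "B \<in> Obj C" using Hom_Obj h by auto
  obtain c where c: "is_cokernel C (d \<cdot> p) c" and k: "is_kernel C c \<mu>" using \<mu> by (auto simp: is_image_def)
  note cM = is_cokernel_Hom[OF c f]
  note \<mu>M = is_kernel_Hom[OF k cM(1)]
  have "d = (d \<cdot> p) \<cdot> d" using Comp_assoc[OF h(1,3,1)] h(5) Comp_Ident[OF h(1)] by simp
  then have "c \<cdot> d = (c \<cdot> (d \<cdot> p)) \<cdot> d" using Comp_assoc[OF h(1) f cM(1)] by simp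
  also have "\<dots> = Zero C K (Cod C c)" using cM Zero_Comp[OF h(1)] Hom_Obj[OF cM(1)] by simp
  finally obtain y where "y \<in> Hom C K (Dom C \<mu>)" "\<mu> \<cdot> y = d" using is_kernel_factor[OF k cM(1) h(1)] by blast
  then show "sub_le C d \<mu>" using sub_leI[OF _ h(1) \<mu>M(1)] by blast
  have "q \<cdot> (d \<cdot> p) = Zero C M B" using Comp_assoc[OF h(3,1,4)] h(6) Zero_Comp[OF h(3) B] by simp
  then obtain t where t: "t \<in> Hom C (Cod C c) B" "t \<cdot> c = q" using is_cokernel_factor[OF c f h(4)] by blast
  have "q \<cdot> \<mu> = Zero C (Dom C \<mu>) B"
    using Comp_assoc[OF \<mu>M(1) cM(1) t(1)] t \<mu>M(2) Comp_Zero[OF t(1)] Hom_Obj[OF \<mu>M(1)] by simp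
  then have "\<mu> = d \<cdot> (p \<cdot> \<mu>)" using is_biproduct_factor[OF bp \<mu>M(1)] by blast
  then show "sub_le C \<mu> d" using sub_leI[OF _ \<mu>M(1) h(1) Comp_in_Hom[OF \<mu>M(1) h(3)]] by blast
qed

text \<open>The Baer conditions return some representative \<open>k\<close> of the summand
  \<open>d\<close>, so the retraction has to be moved to it. With comparison maps \<open>a\<close>
  and \<open>b\<close>, the morphism \<open>a \<cdot> p\<close> serves, because
  \<open>p \<cdot> k = b\<close> and \<open>a \<cdot> b = 1\<close>.\<close>

lemma retraction_cong:
  assumes d: "d \<in> Hom C K M" and p: "p \<in> Hom C M K" and pd: "p \<cdot> d = Ident C K"
    and k: "k \<in> Hom C K' M" and dk: "sub_le C d k" and kd: "sub_le C k d" and mono: "is_mono C k"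
  obtains r where "r \<in> Hom C M K'" "r \<cdot> k = Ident C K'"
proof -
  obtain a where a: "a \<in> Hom C K K'" "d = k \<cdot> a" using sub_leD[OF dk d k] .
  obtain b where b: "b \<in> Hom C K' K" "k = d \<cdot> b" using sub_leD[OF kd k d] .
  have ab: "a \<cdot> b \<in> Hom C K' K'" using Comp_in_Hom[OF b(1) a(1)] .
  have K': "K' \<in> Obj C" using Hom_Obj k by blast
  have "k \<cdot> (a \<cdot> b) = k \<cdot> Ident C K'"
    using Comp_assoc[OF b(1) a(1) k] a(2)[symmetric] b(2)[symmetric] Comp_Ident[OF k] by simp
  then have 1: "a \<cdot> b = Ident C K'" using is_monoD[OF mono k ab Ident_in_Hom[OF K']] by blast
  have pk: "p \<cdot> k = b" using Comp_assoc[OF b(1) d p] b pd Ident_Comp[OF b(1)] by simp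
  have "(a \<cdot> p) \<cdot> k = Ident C K'" using Comp_assoc[OF k p a(1)] pk 1 by simp
  then show thesis using that Comp_in_Hom[OF p a(1)] by blast
qed

text \<open>Restricted to \<open>d\<close>, the retraction of \<open>k\<close> retracts the
  inclusion \<open>h\<close> of \<open>k\<close> in \<open>d\<close>; being essential and split,
  this inclusion is an isomorphism.\<close>

lemma split_essential_in_eq:
  assumes k: "k \<in> Hom C L M" and r: "r \<in> Hom C M L" "r \<cdot> k = Ident C L"
    and d: "d \<in> Hom C K M" and ess: "essential_in C k d"
  shows "sub_le C k d" "sub_le C d k"
proof -
  obtain h where h: "h \<in> Hom C L K" "k = d \<cdot> h" "essential C K h"
    using ess HomD[OF k] HomD[OF d] by (auto simp: essential_in_def)
  show "sub_le C k d" using sub_leI[OF h(2) k d h(1)] .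
  have rd: "r \<cdot> d \<in> Hom C K L" using Comp_in_Hom[OF d r(1)] .
  have "(r \<cdot> d) \<cdot> h = Ident C L" using Comp_assoc[OF h(1) d r(1)] h r by simp
  then have "h \<cdot> (r \<cdot> d) = Ident C K"
    using split_essential_iso[OF h(3), of "r \<cdot> d"] rd HomD[OF h(1)] by simp
  then have "d = k \<cdot> (r \<cdot> d)" using Comp_assoc[OF rd h(1) d] h(2) Comp_Ident[OF d] by simp
  then show "sub_le C d k" using sub_leI[OF _ d k rd] by blast
qed

lemma split_lies_above_eq:
  assumes s: "s \<in> Hom C L M" and r: "r \<in> Hom C M L" "r \<cdot> s = Ident C L"
    and d: "direct_summand C M d" and above: "lies_above C s d"
  shows "sub_le C d s" "sub_le C s d"
proof -
  let ?K = "Dom C d"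
  obtain B j p' q' where bp: "is_biproduct C ?K B M d j p' q'" using direct_summandE[OF d] .
  have dM: "d \<in> Hom C ?K M" and p': "p' \<in> Hom C M ?K" and q': "q' \<in> Hom C M B" "q' \<cdot> d = Zero C ?K B"
    using bp by (auto simp: is_biproduct_def)
  have L: "L \<in> Obj C" using Hom_Obj s by blast
  obtain h p q u where h: "h \<in> Hom C ?K L" "d = s \<cdot> h"
    and p: "is_cokernel C d p" and q: "is_cokernel C h q"
    and u: "u \<in> Hom C (Cod C q) (Cod C p)" "u \<cdot> q = p \<cdot> s" "superfluous C (Cod C p) u"
    using above HomD(2)[OF s] unfolding lies_above_def by auto
  show "sub_le C d s" using sub_leI[OF h(2) dM s h(1)] .
  note pM = is_cokernel_Hom[OF p dM] and qL = is_cokernel_Hom[OF q h(1)]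
  have qr: "q \<cdot> r \<in> Hom C M (Cod C q)" using Comp_in_Hom[OF r(1) qL(1)] .
  have qrs: "(q \<cdot> r) \<cdot> s = q" using Comp_assoc[OF s r(1) qL(1)] r Comp_Ident[OF qL(1)] by simp
  then have "(q \<cdot> r) \<cdot> d = Zero C ?K (Cod C q)" using Comp_assoc[OF h(1) s qr] h(2) qL(2) by simp
  then obtain v where v: "v \<in> Hom C (Cod C p) (Cod C q)" "v \<cdot> p = q \<cdot> r"
    using is_cokernel_factor[OF p dM qr] by blast
  have Q: "Cod C q \<in> Obj C" using Hom_Obj qL by blast
  have vu: "v \<cdot> u \<in> Hom C (Cod C q) (Cod C q)" using Comp_in_Hom[OF u(1) v(1)] .
  have "(v \<cdot> u) \<cdot> q = v \<cdot> (p \<cdot> s)" using Comp_assoc[OF qL(1) u(1) v(1)] u by simp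
  also have "\<dots> = Ident C (Cod C q) \<cdot> q"
    using Comp_assoc[OF s pM(1) v(1)] v qrs Ident_Comp[OF qL(1)] by simp
  finally have "v \<cdot> u = Ident C (Cod C q)"
    using is_cokernel_cancel[OF q h(1) vu Ident_in_Hom[OF Q]] by blast
  then have "u = Zero C (Cod C q) (Cod C p)"
    using split_superfluous_zero[OF u(3), of v] v HomD[OF u(1)] by simp
  then have ps: "p \<cdot> s = Zero C L (Cod C p)" using u(2) Zero_Comp[OF qL(1)] Hom_Obj[OF pM(1)] by simp
  \<comment> \<open>The complementary projection \<open>q'\<close> factors through the quotient by
    \<open>d\<close>, so it kills \<open>s\<close> as well.\<close>
  obtain t where t: "t \<in> Hom C (Cod C p) B" "t \<cdot> p = q'" using is_cokernel_factor[OF p dM q'] .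
  have "q' \<cdot> s = Zero C L B" using Comp_assoc[OF s pM(1) t(1)] t ps Comp_Zero[OF t(1) L] by simp
  then have "s = d \<cdot> (p' \<cdot> s)" using is_biproduct_factor[OF bp s] by blast
  then show "sub_le C s d" using sub_leI[OF _ s dM Comp_in_Hom[OF s p']] by blast
qed

section \<open>The strong conditions and weak duo objects\<close>

lemma strongly_self_CS_Baer_weak_duo:
  assumes "strongly_self_CS_Baer C TYPE('i) M"
  shows "weak_duo C M"
  unfolding weak_duo_def
proof (intro allI impI)
  fix d assume d: "direct_summand C M d"
  then have dsub: "subobject C M d" by (simp add: direct_summand_def)
  obtain B j p q where bp: "is_biproduct C (Dom C d) B M d j p q" using direct_summandE[OF d] .
  have h: "d \<in> Hom C (Dom C d) M" "j \<in> Hom C B M" "p \<in> Hom C M (Dom C d)" "q \<in> Hom C M B"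
    "p \<cdot> d = Ident C (Dom C d)"
    using bp by (auto simp: is_biproduct_def)
  \<comment> \<open>Every type is inhabited, so \<open>undefined\<close> provides a one-element
    index set.\<close>
  define I :: "'i set" where "I = {undefined}"
  \<comment> \<open>The test endomorphism is the projection onto the complement; its kernel is
    \<open>d\<close>.\<close>
  have "j \<cdot> q \<in> Hom C M M" using Comp_in_Hom h by blast
  then obtain \<kappa> k d' where \<kappa>: "\<forall>i\<in>I. is_kernel C (j \<cdot> q) (\<kappa> i)" and int: "is_intersection C M I \<kappa> k"
    and d': "fully_invariant C M d'" "essential_in C k d'"
    using assms[unfolded strongly_self_CS_Baer_def, rule_format, of I "\<lambda>_. j \<cdot> q"] by blast
  have \<kappa>d: "sub_le C d (\<kappa> undefined)" "sub_le C (\<kappa> undefined) d"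
    using kernel_of_projection[OF bp] \<kappa> I_def by auto
  have \<kappa>sub: "subobject C M (\<kappa> undefined)" and ksub: "subobject C M k" and d'sub: "subobject C M d'"
    using int d' I_def by (auto simp: is_intersection_def fully_invariant_def)
  note H = subobject_Hom[OF \<kappa>sub] subobject_Hom[OF ksub] subobject_Hom[OF d'sub]
  have k\<kappa>: "sub_le C k (\<kappa> undefined)" "sub_le C (\<kappa> undefined) k"
    using intersection_singleton int I_def by auto
  have dk: "sub_le C d k" "sub_le C k d"
    using sub_le_trans[OF \<kappa>d(1) k\<kappa>(2) h(1) H(1,2)] sub_le_trans[OF k\<kappa>(1) \<kappa>d(2) H(2,1) h(1)] by auto
  obtain r where r: "r \<in> Hom C M (Dom C k)" "r \<cdot> k = Ident C (Dom C k)"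
    using retraction_cong[OF h(1,3,5) H(2) dk] ksub by (auto simp: subobject_def)
  \<comment> \<open>As \<open>k\<close> splits, it is the same subobject as \<open>d'\<close>, and
    \<open>d\<close> inherits full invariance through \<open>k\<close>.\<close>
  note kd' = split_essential_in_eq[OF H(2) r H(3) d'(2)]
  show "fully_invariant C M d"
    using fully_invariant_cong[OF d'(1) dsub] sub_le_trans[OF dk(1) kd'(1) h(1) H(2,3)]
      sub_le_trans[OF kd'(2) dk(2) H(3,2) h(1)] by blast
qed

lemma dual_strongly_self_CS_Baer_weak_duo:
  assumes "dual_strongly_self_CS_Baer C TYPE('i) M"
  shows "weak_duo C M"
  unfolding weak_duo_def
proof (intro allI impI)
  fix d assume d: "direct_summand C M d"
  then have dsub: "subobject C M d" by (simp add: direct_summand_def)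
  obtain B j p q where bp: "is_biproduct C (Dom C d) B M d j p q" using direct_summandE[OF d] .
  have h: "d \<in> Hom C (Dom C d) M" "p \<in> Hom C M (Dom C d)" "p \<cdot> d = Ident C (Dom C d)"
    using bp by (auto simp: is_biproduct_def)
  define I :: "'i set" where "I = {undefined}"
  \<comment> \<open>In the dual case the test endomorphism is the projection with image
    \<open>d\<close>.\<close>
  have "d \<cdot> p \<in> Hom C M M" using Comp_in_Hom h by blast
  then obtain \<mu> s d' where \<mu>: "\<forall>i\<in>I. is_image C (d \<cdot> p) (\<mu> i)" and sum: "is_sum C M I \<mu> s"
    and d': "direct_summand C M d'" "fully_invariant C M d'" "lies_above C s d'"
    using assms[unfolded dual_strongly_self_CS_Baer_def, rule_format, of I "\<lambda>_. d \<cdot> p"] by blast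
  have \<mu>d: "sub_le C d (\<mu> undefined)" "sub_le C (\<mu> undefined) d"
    using image_of_projection[OF bp] \<mu> I_def by auto
  have \<mu>sub: "subobject C M (\<mu> undefined)" and ssub: "subobject C M s" and d'sub: "subobject C M d'"
    using sum d' I_def by (auto simp: is_sum_def fully_invariant_def)
  note H = subobject_Hom[OF \<mu>sub] subobject_Hom[OF ssub] subobject_Hom[OF d'sub]
  have s\<mu>: "sub_le C s (\<mu> undefined)" "sub_le C (\<mu> undefined) s"
    using sum_singleton sum I_def by auto
  have ds: "sub_le C d s" "sub_le C s d"
    using sub_le_trans[OF \<mu>d(1) s\<mu>(2) h(1) H(1,2)] sub_le_trans[OF s\<mu>(1) \<mu>d(2) H(2,1) h(1)] by auto
  obtain r where r: "r \<in> Hom C M (Dom C s)" "r \<cdot> s = Ident C (Dom C s)"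
    using retraction_cong[OF h H(2) ds] ssub by (auto simp: subobject_def)
  note sd' = split_lies_above_eq[OF H(2) r d'(1,3)]
  show "fully_invariant C M d"
    using fully_invariant_cong[OF d'(2) dsub] sub_le_trans[OF ds(1) sd'(2) h(1) H(2,3)]
      sub_le_trans[OF sd'(1) ds(2) H(3,2) h(1)] by blast
qed

text \<open>Once all direct summands of \<open>M\<close> are fully invariant, the strong and the
  plain condition ask for the same summands; the strong condition itself yields weak duo.\<close>

lemma strongly_self_CS_Baer_iff:
  "strongly_self_CS_Baer C TYPE('i) M \<longleftrightarrow> self_CS_Baer C TYPE('i) M \<and> weak_duo C M"
proof -
  have "strongly_self_CS_Baer C TYPE('i) M \<longleftrightarrow> self_CS_Baer C TYPE('i) M"
    if "weak_duo C M"
  proof -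
    have "direct_summand C M d \<and> fully_invariant C M d \<and> P \<longleftrightarrow> direct_summand C M d \<and> P" for d P
      using that by (auto simp: weak_duo_def)
    then show ?thesis
      by (simp only: self_CS_Baer_def strongly_self_CS_Baer_def)
  qed
  then show ?thesis using strongly_self_CS_Baer_weak_duo by blast
qed

lemma dual_strongly_self_CS_Baer_iff:
  "dual_strongly_self_CS_Baer C TYPE('i) M \<longleftrightarrow> dual_self_CS_Baer C TYPE('i) M \<and> weak_duo C M"
proof -
  have "dual_strongly_self_CS_Baer C TYPE('i) M \<longleftrightarrow> dual_self_CS_Baer C TYPE('i) M"
    if "weak_duo C M"
  proof -
    have "direct_summand C M d \<and> fully_invariant C M d \<and> P \<longleftrightarrow> direct_summand C M d \<and> P" for d P
      using that by (auto simp: weak_duo_def)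
    then show ?thesis
      by (simp only: dual_self_CS_Baer_def dual_strongly_self_CS_Baer_def)
  qed
  then show ?thesis using dual_strongly_self_CS_Baer_weak_duo by blast
qed

end

theorem corollary3p4:
  fixes C :: "('o, 'm) preadd_data" and M :: 'o
  assumes "abelian_category C"
    and "M \<in> Obj C"
  shows "(AB3_star C TYPE('i) \<longrightarrow>
            (strongly_self_CS_Baer C TYPE('i) M \<longleftrightarrow> self_CS_Baer C TYPE('i) M \<and> weak_duo C M) \<and>
            (self_CS_Baer C TYPE('i) M \<and> weak_duo C M \<longleftrightarrow>
               self_CS_Baer C TYPE('i) M \<and> abelian_ring (End_ring C M))) \<and>
         (AB3 C TYPE('i) \<longrightarrow>
            (dual_strongly_self_CS_Baer C TYPE('i) M \<longleftrightarrow> dual_self_CS_Baer C TYPE('i) M \<and> weak_duo C M) \<and>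
            (dual_self_CS_Baer C TYPE('i) M \<and> weak_duo C M \<longleftrightarrow>
               dual_self_CS_Baer C TYPE('i) M \<and> abelian_ring (End_ring C M)))"
  \<comment> \<open>In both halves, passing from (ii) to (iii) only exchanges weak duo for the
    condition on the endomorphism ring.\<close>
  using abelian_category.strongly_self_CS_Baer_iff[OF assms(1)]
    abelian_category.dual_strongly_self_CS_Baer_iff[OF assms(1)]
    abelian_category.weak_duo_iff_abelian_End[OF assms]
  by blast

end
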